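(* Let $p$ be a prime number and $q$ a nonzero integer coprime to $p$. Then $\phi_{p,q}^{-1}(\mathbf{Q})\subset\mathbf{Q}$, where $\phi_{p,q}:\mathbf{Q}_p\to\mathbf{Q}_p$.
   Context: For $x\in\mathbf{Z}_p$, $\epsilon_0(x)\in\{0,1,\dots,p-1\}$ is the unique element with $\epsilon_0(x)\equiv x\pmod p$. The map $g_{p,q}:\mathbf{Z}_p\to\mathbf{Z}_p$ is defined by $g_{p,q}(x)=\frac{x}{p}$ if $p\mid x$ and $g_{p,q}(x)=\frac{qx+\epsilon_0(-qx)}{p}$ otherwise. For $u\in\mathbf{Z}_p$ put $u_n=g_{p,q}^n(u)$ ($n$-th iterate) and $\phi_{p,q}(u)=\sum_{n=0}^\infty\epsilon_0(-qu_n)p^n\in\mathbf{Z}_p$; this defines a bijective isometry of $\mathbf{Z}_p$, which is extended to an isometry of $\mathbf{Q}_p$ by $\phi_{p,q}(p^{-n}u)=p^{-n}\phi_{p,q}(u)$ for all $u\in\mathbf{Z}_p$, $n\in\mathbf{N}$. *)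

theory Defs
  imports Complex_Main "HOL-Computational_Algebra.Primes" "HOL-Algebra.QuotRing"
begin

section \<open>The field of p-adic numbers\<close>

text \<open>
  Since types cannot depend on the prime \<open>p\<close>, the field of \<open>p\<close>-adic numbers is given as a
  carrier-based ring depending on \<open>p\<close>: the completion of the rationals with respect to the
  \<open>p\<close>-adic absolute value, i.e. the ring of Cauchy sequences of rationals modulo the ideal of
  null sequences.
\<close>

definition padic_val :: "nat \<Rightarrow> rat \<Rightarrow> int" where
  "padic_val p r =
     int (multiplicity (int p) (fst (quotient_of r))) -
     int (multiplicity (int p) (snd (quotient_of r)))"

definition padic_abs :: "nat \<Rightarrow> rat \<Rightarrow> real" where
  "padic_abs p r = (if r = 0 then 0 else real p powi (- padic_val p r))"

definition padic_Cauchy :: "nat \<Rightarrow> (nat \<Rightarrow> rat) \<Rightarrow> bool" where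
  "padic_Cauchy p X \<longleftrightarrow>
     (\<forall>e>0. \<exists>M. \<forall>m\<ge>M. \<forall>n\<ge>M. padic_abs p (X m - X n) < e)"

definition Cauchy_ring :: "nat \<Rightarrow> (nat \<Rightarrow> rat) ring" where
  "Cauchy_ring p =
     \<lparr>carrier = {X. padic_Cauchy p X},
      mult = (\<lambda>X Y n. X n * Y n), one = (\<lambda>_. 1),
      zero = (\<lambda>_. 0), add = (\<lambda>X Y n. X n + Y n)\<rparr>"

definition null_seqs :: "nat \<Rightarrow> (nat \<Rightarrow> rat) set" where
  "null_seqs p = {X. (\<lambda>n. padic_abs p (X n)) \<longlonglongrightarrow> 0}"

definition Qp :: "nat \<Rightarrow> (nat \<Rightarrow> rat) set ring" where
  "Qp p = Cauchy_ring p Quot null_seqs p"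

definition Qp_of_rat :: "nat \<Rightarrow> rat \<Rightarrow> (nat \<Rightarrow> rat) set" where
  "Qp_of_rat p r = null_seqs p +>\<^bsub>Cauchy_ring p\<^esub> (\<lambda>_. r)"

abbreviation Qp_of_int :: "nat \<Rightarrow> int \<Rightarrow> (nat \<Rightarrow> rat) set" where
  "Qp_of_int p k \<equiv> Qp_of_rat p (of_int k)"

definition Qp_Rats :: "nat \<Rightarrow> (nat \<Rightarrow> rat) set set" where
  "Qp_Rats p = range (Qp_of_rat p)"

text \<open>The extension of the absolute value; the limit is the same for all representatives.\<close>

definition Qp_abs :: "nat \<Rightarrow> (nat \<Rightarrow> rat) set \<Rightarrow> real" where
  "Qp_abs p x = (THE c. \<forall>X\<in>x. (\<lambda>n. padic_abs p (X n)) \<longlonglongrightarrow> c)"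

definition Zp :: "nat \<Rightarrow> (nat \<Rightarrow> rat) set set" where
  "Zp p = {x \<in> carrier (Qp p). Qp_abs p x \<le> 1}"

definition Zp_p_dvd :: "nat \<Rightarrow> (nat \<Rightarrow> rat) set \<Rightarrow> bool" where
  "Zp_p_dvd p x \<longleftrightarrow> (\<exists>y\<in>Zp p. x = Qp_of_int p (int p) \<otimes>\<^bsub>Qp p\<^esub> y)"

definition Qp_divide :: "nat \<Rightarrow> (nat \<Rightarrow> rat) set \<Rightarrow> (nat \<Rightarrow> rat) set \<Rightarrow> (nat \<Rightarrow> rat) set" where
  "Qp_divide p x y = x \<otimes>\<^bsub>Qp p\<^esub> inv\<^bsub>Qp p\<^esub> y"

definition Qp_sums :: "nat \<Rightarrow> (nat \<Rightarrow> (nat \<Rightarrow> rat) set) \<Rightarrow> (nat \<Rightarrow> rat) set \<Rightarrow> bool" where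
  "Qp_sums p a s \<longleftrightarrow> s \<in> carrier (Qp p) \<and>
     (\<lambda>N. Qp_abs p ((\<Oplus>\<^bsub>Qp p\<^esub>n\<in>{..<N}. a n) \<ominus>\<^bsub>Qp p\<^esub> s)) \<longlonglongrightarrow> 0"


section \<open>The maps\<close>

definition eps0 :: "nat \<Rightarrow> (nat \<Rightarrow> rat) set \<Rightarrow> int" where
  "eps0 p x = (THE d. d \<in> {0..int p - 1} \<and> Zp_p_dvd p (x \<ominus>\<^bsub>Qp p\<^esub> Qp_of_int p d))"

definition gmap :: "nat \<Rightarrow> int \<Rightarrow> (nat \<Rightarrow> rat) set \<Rightarrow> (nat \<Rightarrow> rat) set" where
  "gmap p q x =
     (if Zp_p_dvd p x then Qp_divide p x (Qp_of_int p (int p))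
      else Qp_divide p
             (Qp_of_int p q \<otimes>\<^bsub>Qp p\<^esub> x \<oplus>\<^bsub>Qp p\<^esub>
                Qp_of_int p (eps0 p (\<ominus>\<^bsub>Qp p\<^esub> (Qp_of_int p q \<otimes>\<^bsub>Qp p\<^esub> x))))
             (Qp_of_int p (int p)))"

definition phi_Zp :: "nat \<Rightarrow> int \<Rightarrow> (nat \<Rightarrow> rat) set \<Rightarrow> (nat \<Rightarrow> rat) set" where
  "phi_Zp p q u = (THE s. Qp_sums p
     (\<lambda>n. Qp_of_int p
              (eps0 p (\<ominus>\<^bsub>Qp p\<^esub> (Qp_of_int p q \<otimes>\<^bsub>Qp p\<^esub> (gmap p q ^^ n) u))) \<otimes>\<^bsub>Qp p\<^esub>
            Qp_of_int p (int p) [^]\<^bsub>Qp p\<^esub> n) s)"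

text \<open>
  The extension to the whole field is the function that satisfies
  \<open>\<phi>(p\<^sup>-\<^sup>n u) = p\<^sup>-\<^sup>n \<phi>(u)\<close> for all \<open>u\<close> in \<open>Zp p\<close> and all \<open>n\<close>; every element of the field has
  the form \<open>p\<^sup>-\<^sup>n u\<close>, and the value does not depend on this representation because
  \<open>\<phi>(p u) = p \<phi>(u)\<close> on \<open>Zp p\<close>.
\<close>

definition phi :: "nat \<Rightarrow> int \<Rightarrow> (nat \<Rightarrow> rat) set \<Rightarrow> (nat \<Rightarrow> rat) set" where
  "phi p q x = (THE y. \<forall>n::nat. \<forall>u\<in>Zp p.
     x = Qp_divide p u (Qp_of_int p (int p) [^]\<^bsub>Qp p\<^esub> n) \<longrightarrow>
     y = Qp_divide p (phi_Zp p q u) (Qp_of_int p (int p) [^]\<^bsub>Qp p\<^esub> n))"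

end

theory Submission
  imports Defs
begin

text \<open>
  Write \<open>u\<^sub>n\<close> for the iterates of a p-adic integer \<open>u\<close> and \<open>d\<^sub>n\<close> for the digit
  \<open>\<epsilon>\<^sub>0(- q u\<^sub>n)\<close>. One step of the iteration is an affine map over the rationals that
  depends only on the digit: \<open>p u\<^sub>n\<^sub>+\<^sub>1 = c u\<^sub>n + d\<^sub>n\<close>, where \<open>c = 1\<close> if \<open>d\<^sub>n = 0\<close> and
  \<open>c = q\<close> otherwise (\<open>g_aff\<close>). Its inverse contracts distances by the factor
  \<open>1/p\<close>, because \<open>q\<close> is a p-adic unit. Hence the digits determine \<open>u\<close>, and \<open>\<phi>\<close> is injective on the
  p-adic integers (\<open>phi0_inj\<close>).

  The series that defines \<open>\<phi>\<close> satisfies \<open>\<phi>(u\<^sub>n) = d\<^sub>n + p \<phi>(u\<^sub>n\<^sub>+\<^sub>1)\<close> (\<open>phi0_rec\<close>). If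
  \<open>\<phi>(u)\<close> is the rational number \<open>a/b\<close>, then so is every \<open>\<phi>(u\<^sub>n)\<close>, with the same denominator
  \<open>b\<close> and with a numerator that stays bounded (\<open>remainder_finite\<close>). By the pigeonhole principle
  \<open>\<phi>(u\<^sub>n) = \<phi>(u\<^sub>m)\<close> for some \<open>n < m\<close>, and injectivity gives \<open>u\<^sub>n = u\<^sub>m\<close>. So \<open>u\<^sub>n\<close> is a
  fixed point of a contracting affine map with rational coefficients, which makes it rational
  (\<open>aff_fixed_point_rational\<close>); \<open>u\<close> is the image of \<open>u\<^sub>n\<close> under another such map.

  An arbitrary p-adic number is \<open>p\<^sup>-\<^sup>k u\<close> with \<open>u\<close> integral, and
  \<open>\<phi>(p\<^sup>-\<^sup>k u) = p\<^sup>-\<^sup>k \<phi>(u)\<close> (\<open>phi_scale\<close>) reduces the general case to this one.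
\<close>

section \<open>The p-adic absolute value on the rationals\<close>

text \<open>
  The structure \<open>R\<close> is only a name for \<open>Qp p\<close>; as a structure parameter it makes the ring
  operations available without subscripts.
\<close>

locale padic =
  fixes p :: nat and R (structure)
  assumes prime_p: "prime p" and R_def: "R = Qp p"
begin

abbreviation v :: "rat \<Rightarrow> real" where "v \<equiv> padic_abs p"

lemma p_gt_1: "p > 1"
  using prime_p prime_gt_1_nat by blast

lemma prime_int_p: "prime (int p)"
  using prime_p by simp

lemma padic_val_fraction:
  assumes "a \<noteq> 0" "b \<noteq> 0"
  shows "padic_val p (of_int a / of_int b) =
    int (multiplicity (int p) a) - int (multiplicity (int p) b)"
proof -
  obtain c d where cd: "quotient_of (of_int a / of_int b) = (c, d)"
    by fastforce
  have d: "d > 0"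
    using quotient_of_denom_pos[OF cd] .
  have "(of_int a / of_int b :: rat) = of_int c / of_int d"
    using quotient_of_div[OF cd] .
  then have "(of_int (a * d) :: rat) = of_int (c * b)"
    using assms d by (simp add: field_simps)
  then have eq: "a * d = c * b"
    by linarith
  then have "c \<noteq> 0"
    using assms d by auto
  then have "multiplicity (int p) a + multiplicity (int p) d =
      multiplicity (int p) c + multiplicity (int p) b"
    using arg_cong[OF eq, of "multiplicity (int p)"] assms d prime_int_p
    by (simp add: prime_elem_multiplicity_mult_distrib)
  then show ?thesis
    by (simp add: padic_val_def cd)
qed

lemma v_0 [simp]: "v 0 = 0"
  by (simp add: padic_abs_def)

lemma v_fraction:
  assumes "a \<noteq> 0" "b \<noteq> 0"
  shows "v (of_int a / of_int b) = real p ^ multiplicity (int p) b / real p ^ multiplicity (int p) a"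
  using assms p_gt_1
  by (simp add: padic_abs_def padic_val_fraction power_int_diff)

lemma v_of_int: "a \<noteq> 0 \<Longrightarrow> v (of_int a) = 1 / real p ^ multiplicity (int p) a"
  using v_fraction[of a 1] by simp

lemma rat_fraction:
  obtains a b where "(r::rat) = of_int a / of_int b" "b > 0" "coprime a b"
  by (metis quotient_of_div quotient_of_denom_pos quotient_of_coprime surj_pair)

lemma v_mult [simp]: "v (x * y) = v x * v y"
proof (cases "x = 0 \<or> y = 0")
  case False
  obtain a b where x: "x = of_int a / of_int b" "b > 0"
    using rat_fraction by metis
  obtain c d where y: "y = of_int c / of_int d" "d > 0"
    using rat_fraction by metis
  have "a \<noteq> 0" "c \<noteq> 0"
    using False x y by auto
  moreover have "x * y = of_int (a * c) / of_int (b * d)"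
    using x y by simp
  ultimately show ?thesis
    using x y v_fraction[of a b] v_fraction[of c d] v_fraction[of "a * c" "b * d"] prime_int_p
    by (simp add: prime_elem_multiplicity_mult_distrib power_add)
qed auto

lemma v_nonneg [simp]: "v x \<ge> 0"
  by (simp add: padic_abs_def)

lemma v_eq_0_iff [simp]: "v x = 0 \<longleftrightarrow> x = 0"
  using p_gt_1 by (simp add: padic_abs_def)

lemma v_1 [simp]: "v 1 = 1"
  using v_of_int[of 1] by simp

lemma v_minus [simp]: "v (- x) = v x"
proof -
  have "(v (- 1))\<^sup>2 = 1"
    by (simp add: power2_eq_square flip: v_mult)
  then have "v (- 1) = 1"
    using v_nonneg[of "- 1"] by (auto simp: power2_eq_1_iff simp del: v_nonneg)
  then show ?thesis
    using v_mult[of "- 1" x] by simp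
qed

lemma v_minus_commute: "v (x - y) = v (y - x)"
  using v_minus[of "x - y"] by simp

lemma v_divide [simp]: "v (x / y) = v x / v y"
proof (cases "y = 0")
  case False
  then have "v (x / y) * v y = v x"
    by (simp flip: v_mult)
  then show ?thesis
    using False by (simp add: field_simps)
qed auto

lemma v_of_int_le_1 [simp]: "v (of_int a) \<le> 1"
  using p_gt_1 by (cases "a = 0") (auto simp: v_of_int)

lemma v_p [simp]: "v (of_nat p) = 1 / real p"
proof -
  have "multiplicity (int p) (int p) = 1"
    using prime_int_p by (intro multiplicity_self) auto
  then show ?thesis
    using v_of_int[of "int p"] p_gt_1 by simp
qed

lemma v_power [simp]: "v (x ^ n) = v x ^ n"
  by (induction n) auto

lemma v_of_int_le_inverse_p_iff: "v (of_int a) \<le> 1 / real p \<longleftrightarrow> int p dvd a"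
proof
  assume "int p dvd a"
  then obtain b where "a = int p * b" ..
  then show "v (of_int a) \<le> 1 / real p"
    using v_of_int_le_1[of b] by (simp add: divide_right_mono)
next
  assume le: "v (of_int a) \<le> 1 / real p"
  show "int p dvd a"
  proof (rule ccontr)
    assume "\<not> int p dvd a"
    then have "multiplicity (int p) a = 0" "a \<noteq> 0"
      by (auto simp: not_dvd_imp_multiplicity_0)
    then show False
      using le p_gt_1 by (simp add: v_of_int)
  qed
qed

lemma v_of_int_coprime:
  assumes "coprime a (int p)"
  shows "v (of_int a) = 1"
proof -
  have "\<not> int p dvd a"
    using assms prime_int_p by (metis coprime_absorb_right not_prime_unit)
  then show ?thesis
    using v_of_int[of a] by (auto simp: not_dvd_imp_multiplicity_0)
qed

lemma v_of_int_add_le: "v (of_int (a + b)) \<le> max (v (of_int a)) (v (of_int b))"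
proof (cases "a = 0 \<or> b = 0 \<or> a + b = 0")
  case False
  define k where "k = min (multiplicity (int p) a) (multiplicity (int p) b)"
  have "int p ^ k dvd a + b"
    by (intro dvd_add multiplicity_dvd') (auto simp: k_def)
  then have "k \<le> multiplicity (int p) (a + b)"
    using False prime_int_p by (intro multiplicity_geI) auto
  then have "real p ^ k \<le> real p ^ multiplicity (int p) (a + b)"
    using p_gt_1 by (intro power_increasing) auto
  then have "1 / real p ^ multiplicity (int p) (a + b) \<le> 1 / real p ^ k"
    using p_gt_1 by (intro divide_left_mono) auto
  also have "\<dots> \<le> max (v (of_int a)) (v (of_int b))"
    using False by (auto simp: v_of_int k_def min_def)
  finally show ?thesis
    using False v_of_int[of "a + b"] by (simp del: of_int_add)
next
  case True
  then show ?thesis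
    by (auto simp add: le_max_iff_disj simp del: of_int_add)
qed

lemma v_add_le: "v (x + y) \<le> max (v x) (v y)"
proof -
  obtain a b where x: "x = of_int a / of_int b" "b > 0"
    using rat_fraction by metis
  obtain c d where y: "y = of_int c / of_int d" "d > 0"
    using rat_fraction by metis
  have x': "x = of_int (a * d) / of_int (b * d)" and y': "y = of_int (c * b) / of_int (b * d)"
    using x y by auto
  have "x + y = of_int (a * d + c * b) / of_int (b * d)"
    using x y by (simp add: field_simps)
  then have "v (x + y) = v (of_int (a * d + c * b)) / v (of_int (b * d))"
    by (simp only: v_divide)
  also have "\<dots> \<le> max (v (of_int (a * d))) (v (of_int (c * b))) / v (of_int (b * d))"
    by (intro divide_right_mono v_of_int_add_le v_nonneg)
  also have "\<dots> = max (v x) (v y)"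
    unfolding x' y' v_divide using v_nonneg[of "of_int (b * d)"]
    by (metis max_divide_distrib_right)
  finally show ?thesis .
qed

lemma v_diff_le: "v (x - y) \<le> max (v x) (v y)"
  using v_add_le[of x "- y"] by simp

lemma v_add_le_sum: "v (x + y) \<le> v x + v y"
  using v_add_le[of x y] v_nonneg[of x] v_nonneg[of y] by linarith

lemma abs_v_diff_le: "\<bar>v x - v y\<bar> \<le> v (x - y)"
  using v_add_le_sum[of "x - y" y] v_add_le_sum[of "y - x" x] v_minus_commute[of x y] by simp

text \<open>
  The denominator of a fraction of absolute value at most 1 is prime to \<open>p\<close>, so the fraction can be
  reduced modulo \<open>p\<close>.
\<close>

lemma v_digit_exists:
  assumes "v r \<le> 1"
  shows "\<exists>d\<in>{0..int p - 1}. v (r - of_int d) \<le> 1 / real p"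
proof -
  obtain a b where r: "r = of_int a / of_int b" "b > 0" "coprime a b"
    using rat_fraction by metis
  have nb: "\<not> int p dvd b"
  proof
    assume b: "int p dvd b"
    then have "\<not> int p dvd a"
      using r(3) prime_int_p by (meson coprime_common_divisor not_prime_unit)
    then have "v (of_int a) = 1"
      using prime_int_p by (intro v_of_int_coprime) (metis coprime_commute prime_imp_coprime)
    moreover have "v (of_int b) < 1"
      using v_of_int_le_inverse_p_iff[of b] b p_gt_1 by (smt (verit) divide_less_eq_1_pos of_nat_1 of_nat_less_iff)
    moreover have "v (of_int b) > 0"
      using r(2) by (simp add: order.strict_iff_order)
    ultimately show False
      using assms r(1) by simp
  qed
  then have cop: "coprime b (int p)"
    using prime_int_p by (metis coprime_commute prime_imp_coprime)
  then obtain s t where st: "s * b + t * int p = 1"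
    using bezout_int[of b "int p"] by auto
  define d where "d = (s * a) mod int p"
  have "b * d mod int p = b * (s * a) mod int p"
    by (simp add: d_def mod_mult_right_eq)
  also have "b * (s * a) = a + int p * (- t * a)"
    using arg_cong[OF st, of "\<lambda>x. x * a"] by (simp add: algebra_simps)
  finally have "int p dvd a - b * d"
    by (metis mod_mult_self2 mod_eq_dvd_iff)
  moreover have "r - of_int d = of_int (a - b * d) / of_int b"
    using r by (simp add: field_simps)
  ultimately have "v (r - of_int d) \<le> 1 / real p"
    using v_of_int_coprime[OF cop] v_of_int_le_inverse_p_iff[of "a - b * d"] by (simp only: v_divide div_by_1)
  moreover have "d \<in> {0..int p - 1}"
    using p_gt_1 by (simp add: d_def)
  ultimately show ?thesis
    by blast
qed

section \<open>The ring of p-adic numbers\<close>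

abbreviation C :: "(nat \<Rightarrow> rat) ring" where "C \<equiv> Cauchy_ring p"

lemma Cauchy_add:
  assumes "padic_Cauchy p X" "padic_Cauchy p Y"
  shows "padic_Cauchy p (\<lambda>n. X n + Y n)"
  unfolding padic_Cauchy_def
proof (intro allI impI)
  fix e :: real assume "e > 0"
  then obtain M N where M: "\<And>m n. m \<ge> M \<Longrightarrow> n \<ge> M \<Longrightarrow> v (X m - X n) < e"
    and N: "\<And>m n. m \<ge> N \<Longrightarrow> n \<ge> N \<Longrightarrow> v (Y m - Y n) < e"
    using assms unfolding padic_Cauchy_def by metis
  have "v (X m + Y m - (X n + Y n)) < e" if "m \<ge> max M N" "n \<ge> max M N" for m n
    using v_add_le[of "X m - X n" "Y m - Y n"] M[of m n] N[of m n] that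
    by (simp add: algebra_simps)
  then show "\<exists>M. \<forall>m\<ge>M. \<forall>n\<ge>M. v (X m + Y m - (X n + Y n)) < e"
    by blast
qed

lemma Cauchy_convergent_v:
  assumes "padic_Cauchy p X"
  shows "convergent (\<lambda>n. v (X n))"
proof (rule Cauchy_convergent, rule CauchyI)
  fix e :: real assume "e > 0"
  then obtain M where "\<forall>m\<ge>M. \<forall>n\<ge>M. v (X m - X n) < e"
    using assms unfolding padic_Cauchy_def by blast
  then show "\<exists>M. \<forall>m\<ge>M. \<forall>n\<ge>M. norm (v (X m) - v (X n)) < e"
    using abs_v_diff_le by (metis order.strict_trans1 real_norm_def)
qed

lemma Cauchy_bounded:
  assumes "padic_Cauchy p X"
  obtains B where "B > 0" "\<And>n. v (X n) \<le> B"
proof -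
  have "Bseq (\<lambda>n. v (X n))"
    using Cauchy_convergent_v[OF assms] by (rule convergent_imp_Bseq)
  then obtain K where "K > 0" "\<forall>n. norm (v (X n)) \<le> K"
    by (rule BseqE)
  then show ?thesis
    using that by fastforce
qed

lemma Cauchy_mult:
  assumes "padic_Cauchy p X" "padic_Cauchy p Y"
  shows "padic_Cauchy p (\<lambda>n. X n * Y n)"
  unfolding padic_Cauchy_def
proof (intro allI impI)
  obtain A where A: "A > 0" "\<And>n. v (X n) \<le> A"
    using Cauchy_bounded[OF assms(1)] by blast
  obtain B where B: "B > 0" "\<And>n. v (Y n) \<le> B"
    using Cauchy_bounded[OF assms(2)] by blast
  fix e :: real assume e: "e > 0"
  obtain M where M: "\<And>m n. m \<ge> M \<Longrightarrow> n \<ge> M \<Longrightarrow> v (X m - X n) < e / B"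
    using assms(1) e B unfolding padic_Cauchy_def by (metis divide_pos_pos)
  obtain N where N: "\<And>m n. m \<ge> N \<Longrightarrow> n \<ge> N \<Longrightarrow> v (Y m - Y n) < e / A"
    using assms(2) e A unfolding padic_Cauchy_def by (metis divide_pos_pos)
  have "v (X m * Y m - X n * Y n) < e" if "m \<ge> max M N" "n \<ge> max M N" for m n
  proof -
    have "X m * Y m - X n * Y n = X m * (Y m - Y n) + (X m - X n) * Y n"
      by (simp add: algebra_simps)
    then have "v (X m * Y m - X n * Y n) \<le> max (v (X m) * v (Y m - Y n)) (v (X m - X n) * v (Y n))"
      using v_add_le by (metis v_mult)
    moreover have "v (X m) * v (Y m - Y n) < A * (e / A)"
      using N[of m n] A that by (intro order.strict_trans1[OF mult_right_mono mult_strict_left_mono]) auto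
    moreover have "v (X m - X n) * v (Y n) < (e / B) * B"
      using M[of m n] B that by (intro order.strict_trans1[OF mult_left_mono mult_strict_right_mono]) auto
    ultimately show ?thesis
      using A B by auto
  qed
  then show "\<exists>M. \<forall>m\<ge>M. \<forall>n\<ge>M. v (X m * Y m - X n * Y n) < e"
    by blast
qed

lemma Cauchy_const [simp]: "padic_Cauchy p (\<lambda>_. r)"
  by (simp add: padic_Cauchy_def)

lemma Cauchy_uminus: "padic_Cauchy p X \<Longrightarrow> padic_Cauchy p (\<lambda>n. - X n)"
  using Cauchy_mult[of "\<lambda>_. - 1" X] by simp

lemma Cauchy_diff: "padic_Cauchy p X \<Longrightarrow> padic_Cauchy p Y \<Longrightarrow> padic_Cauchy p (\<lambda>n. X n - Y n)"
  using Cauchy_add[of X "\<lambda>n. - Y n"] Cauchy_uminus by simp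

lemma null_seqs_iff: "X \<in> null_seqs p \<longleftrightarrow> (\<lambda>n. v (X n)) \<longlonglongrightarrow> 0"
  by (simp add: null_seqs_def)

lemma null_add:
  assumes "X \<in> null_seqs p" "Y \<in> null_seqs p"
  shows "(\<lambda>n. X n + Y n) \<in> null_seqs p"
  unfolding null_seqs_iff
proof (rule tendsto_sandwich[where f = "\<lambda>_. 0"])
  show "(\<lambda>n. v (X n) + v (Y n)) \<longlonglongrightarrow> 0"
    using assms tendsto_add[of "\<lambda>n. v (X n)" 0 sequentially "\<lambda>n. v (Y n)" 0]
    by (simp add: null_seqs_iff)
  show "\<forall>\<^sub>F n in sequentially. v (X n + Y n) \<le> v (X n) + v (Y n)"
  proof (rule always_eventually, rule allI)
    fix n
    show "v (X n + Y n) \<le> v (X n) + v (Y n)"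
      using v_add_le[of "X n" "Y n"] v_nonneg[of "X n"] v_nonneg[of "Y n"] by linarith
  qed
qed auto

lemma null_mult:
  assumes "X \<in> null_seqs p" "padic_Cauchy p Y"
  shows "(\<lambda>n. X n * Y n) \<in> null_seqs p"
proof -
  obtain B where B: "B > 0" "\<And>n. v (Y n) \<le> B"
    using Cauchy_bounded[OF assms(2)] by blast
  show ?thesis
    unfolding null_seqs_iff
  proof (rule tendsto_sandwich[where f = "\<lambda>_. 0"])
    show "(\<lambda>n. v (X n) * B) \<longlonglongrightarrow> 0"
      using assms(1) by (auto simp: null_seqs_iff intro!: tendsto_mult_left_zero)
    show "\<forall>\<^sub>F n in sequentially. v (X n * Y n) \<le> v (X n) * B"
      using B by (auto intro!: always_eventually mult_left_mono)
  qed auto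
qed

lemma null_uminus: "X \<in> null_seqs p \<Longrightarrow> (\<lambda>n. - X n) \<in> null_seqs p"
  by (simp add: null_seqs_iff)

lemma null_Cauchy:
  assumes "X \<in> null_seqs p"
  shows "padic_Cauchy p X"
  unfolding padic_Cauchy_def
proof (intro allI impI)
  fix e :: real assume "e > 0"
  then obtain M where M: "\<And>n. n \<ge> M \<Longrightarrow> v (X n) < e"
    using assms LIMSEQ_D[of "\<lambda>n. v (X n)" 0 e] by (auto simp: null_seqs_iff)
  have "v (X m - X n) < e" if "m \<ge> M" "n \<ge> M" for m n
    using v_diff_le[of "X m" "X n"] M[OF that(1)] M[OF that(2)] by linarith
  then show "\<exists>M. \<forall>m\<ge>M. \<forall>n\<ge>M. v (X m - X n) < e"
    by blast
qed

lemma Cauchy_ring_simps [simp]: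
  "carrier C = {X. padic_Cauchy p X}" "X \<otimes>\<^bsub>C\<^esub> Y = (\<lambda>n. X n * Y n)"
  "X \<oplus>\<^bsub>C\<^esub> Y = (\<lambda>n. X n + Y n)" "\<one>\<^bsub>C\<^esub> = (\<lambda>_. 1)" "\<zero>\<^bsub>C\<^esub> = (\<lambda>_. 0)"
  by (simp_all add: Cauchy_ring_def)

lemma cring_C: "cring C"
proof (rule cringI)
  show "abelian_group C"
  proof (rule abelian_groupI)
    fix X assume "X \<in> carrier C"
    then show "\<exists>Y\<in>carrier C. Y \<oplus>\<^bsub>C\<^esub> X = \<zero>\<^bsub>C\<^esub>"
      by (intro bexI[of _ "\<lambda>n. - X n"]) (auto simp: Cauchy_uminus)
  qed (auto simp: Cauchy_add algebra_simps)
  show "comm_monoid C"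
    by (rule comm_monoidI) (auto simp: Cauchy_mult algebra_simps)
qed (auto simp: algebra_simps)

lemma C_a_inv: "padic_Cauchy p X \<Longrightarrow> \<ominus>\<^bsub>C\<^esub> X = (\<lambda>n. - X n)"
proof -
  interpret cring C by (rule cring_C)
  assume "padic_Cauchy p X"
  then show ?thesis
    by (intro minus_equality) (auto simp: Cauchy_uminus)
qed

lemma ideal_null_seqs: "ideal (null_seqs p) C"
proof -
  interpret cring C by (rule cring_C)
  show ?thesis
  proof (rule idealI)
    show "ring C" by (rule ring_axioms)
    show "subgroup (null_seqs p) (add_monoid C)"
    proof (rule add.subgroupI)
      show "null_seqs p \<subseteq> carrier C"
        by (auto simp: null_Cauchy)
      show "null_seqs p \<noteq> {}"
        using null_seqs_iff[of "\<lambda>_. 0"] by auto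
    qed (auto simp: C_a_inv null_Cauchy null_uminus null_add)
  next
    fix X Y assume "X \<in> null_seqs p" "Y \<in> carrier C"
    then show "Y \<otimes>\<^bsub>C\<^esub> X \<in> null_seqs p" "X \<otimes>\<^bsub>C\<^esub> Y \<in> null_seqs p"
      using null_mult[of X Y] by (auto simp: mult.commute)
  qed
qed

definition cls :: "(nat \<Rightarrow> rat) \<Rightarrow> (nat \<Rightarrow> rat) set" where
  "cls X = null_seqs p +>\<^bsub>C\<^esub> X"


sublocale ring_hom_cring C R cls
  unfolding R_def cls_def Qp_def
  using ideal.rcos_ring_hom_cring[OF ideal_null_seqs cring_C] .

text \<open>
  Most identities between p-adic numbers below are proved by choosing representing Cauchy sequences
  with this lemma and comparing them termwise.
\<close>

lemma cls_surj:
  assumes "x \<in> carrier R"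
  obtains X where "padic_Cauchy p X" "x = cls X"
  using assms by (auto simp: R_def Qp_def cls_def FactRing_def A_RCOSETS_def')

lemma cls_add: "padic_Cauchy p X \<Longrightarrow> padic_Cauchy p Y \<Longrightarrow> cls X \<oplus> cls Y = cls (\<lambda>n. X n + Y n)"
  using hom_add[of X Y] by simp

lemma cls_mult: "padic_Cauchy p X \<Longrightarrow> padic_Cauchy p Y \<Longrightarrow> cls X \<otimes> cls Y = cls (\<lambda>n. X n * Y n)"
  using hom_mult[of X Y] by simp

lemma cls_uminus: "padic_Cauchy p X \<Longrightarrow> \<ominus> cls X = cls (\<lambda>n. - X n)"
  using hom_a_inv[of X] by (simp add: C_a_inv)

lemma cls_diff: "padic_Cauchy p X \<Longrightarrow> padic_Cauchy p Y \<Longrightarrow> cls X \<ominus> cls Y = cls (\<lambda>n. X n - Y n)"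
  by (simp add: a_minus_def cls_uminus cls_add Cauchy_uminus)

lemma cls_eq_iff:
  assumes "padic_Cauchy p X" "padic_Cauchy p Y"
  shows "cls X = cls Y \<longleftrightarrow> (\<lambda>n. X n - Y n) \<in> null_seqs p"
  using R.quotient_eq_iff_same_a_r_cos[OF ideal_null_seqs, of X Y] assms
  by (simp add: cls_def a_minus_def C_a_inv)

lemma cls_eqI:
  assumes "padic_Cauchy p X" "padic_Cauchy p Y" "(\<lambda>n. v (X n - Y n)) \<longlonglongrightarrow> 0"
  shows "cls X = cls Y"
  using assms by (simp add: cls_eq_iff null_seqs_iff)

lemma mem_cls_iff:
  assumes "padic_Cauchy p X"
  shows "Y \<in> cls X \<longleftrightarrow> (\<lambda>n. Y n - X n) \<in> null_seqs p"
proof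
  assume "Y \<in> cls X"
  then show "(\<lambda>n. Y n - X n) \<in> null_seqs p"
    by (auto simp: cls_def a_r_coset_def')
next
  assume "(\<lambda>n. Y n - X n) \<in> null_seqs p"
  then show "Y \<in> cls X"
    by (force simp: cls_def a_r_coset_def')
qed

abbreviation \<iota> :: "rat \<Rightarrow> (nat \<Rightarrow> rat) set" where "\<iota> \<equiv> Qp_of_rat p"

lemma \<iota>_cls: "\<iota> r = cls (\<lambda>_. r)"
  by (simp add: Qp_of_rat_def cls_def)

lemma \<iota>_closed [simp]: "\<iota> r \<in> carrier R"
  by (simp add: \<iota>_cls)

lemma \<iota>_add: "\<iota> a \<oplus> \<iota> b = \<iota> (a + b)"
  by (simp add: \<iota>_cls cls_add)

lemma \<iota>_mult: "\<iota> a \<otimes> \<iota> b = \<iota> (a * b)"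
  by (simp add: \<iota>_cls cls_mult)

lemma \<iota>_1: "\<iota> 1 = \<one>"
  using hom_one by (simp add: \<iota>_cls)

lemma \<iota>_0: "\<iota> 0 = \<zero>"
  using hom_zero by (simp add: \<iota>_cls)

lemma \<iota>_power: "\<iota> a [^] (n::nat) = \<iota> (a ^ n)"
  by (induction n) (simp_all add: \<iota>_1 \<iota>_mult mult.commute)

lemma \<iota>_sum: "(\<Oplus>n\<in>{..<N::nat}. \<iota> (f n)) = \<iota> (\<Sum>n<N. f n)"
  by (induction N) (simp_all add: \<iota>_0 lessThan_Suc \<iota>_add add.commute)

lemma \<iota>_inverse: "a \<noteq> 0 \<Longrightarrow> inv (\<iota> a) = \<iota> (1 / a)"
  by (intro S.comm_inv_char) (auto simp: \<iota>_mult \<iota>_1)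

section \<open>The absolute value on the p-adic numbers\<close>

abbreviation nrm :: "(nat \<Rightarrow> rat) set \<Rightarrow> real" where "nrm \<equiv> Qp_abs p"

text \<open>
  The absolute values along a Cauchy sequence form a real Cauchy sequence, and a null sequence does
  not change their limit; so the description defining \<open>Qp_abs\<close> denotes. All properties of
  \<open>Qp_abs\<close> are then inherited from the rationals by passing to the limit.
\<close>

lemma nrm_cls:
  assumes "padic_Cauchy p X"
  shows "(\<lambda>n. v (X n)) \<longlonglongrightarrow> nrm (cls X)"
proof -
  obtain c where c: "(\<lambda>n. v (X n)) \<longlonglongrightarrow> c"
    using Cauchy_convergent_v[OF assms] by (auto simp: convergent_def)
  have Y: "(\<lambda>n. v (Y n)) \<longlonglongrightarrow> c" if "Y \<in> cls X" for Y
  proof -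
    have "(\<lambda>n. v (Y n - X n)) \<longlonglongrightarrow> 0"
      using that mem_cls_iff[OF assms] by (simp add: null_seqs_iff)
    then have "(\<lambda>n. \<bar>v (Y n) - v (X n)\<bar>) \<longlonglongrightarrow> 0"
      by (rule tendsto_sandwich[where f = "\<lambda>_. 0", rotated 3]) (auto simp: abs_v_diff_le)
    then have "(\<lambda>n. v (Y n) - v (X n)) \<longlonglongrightarrow> 0"
      by (rule tendsto_rabs_zero_cancel)
    then show ?thesis
      using tendsto_add[OF _ c, of "\<lambda>n. v (Y n) - v (X n)" 0] by simp
  qed
  have X: "X \<in> cls X"
    using assms by (simp add: mem_cls_iff null_seqs_iff)
  have "nrm (cls X) = c"
    unfolding Qp_abs_def
  proof (rule the_equality)
    show "\<forall>Y\<in>cls X. (\<lambda>n. v (Y n)) \<longlonglongrightarrow> c"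
      using Y by blast
    show "d = c" if "\<forall>Y\<in>cls X. (\<lambda>n. v (Y n)) \<longlonglongrightarrow> d" for d
      using that X LIMSEQ_unique c by blast
  qed
  then show ?thesis
    using c by simp
qed

lemma nrm_nonneg: "x \<in> carrier R \<Longrightarrow> nrm x \<ge> 0"
  by (erule cls_surj) (auto intro: LIMSEQ_le_const nrm_cls)

lemma nrm_\<iota> [simp]: "nrm (\<iota> r) = v r"
  using LIMSEQ_unique[OF nrm_cls[of "\<lambda>_. r"] tendsto_const] by (simp add: \<iota>_cls)

lemma nrm_mult:
  assumes "x \<in> carrier R" "y \<in> carrier R"
  shows "nrm (x \<otimes> y) = nrm x * nrm y"
proof -
  obtain X Y where X: "padic_Cauchy p X" "x = cls X" and Y: "padic_Cauchy p Y" "y = cls Y"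
    using assms cls_surj by metis
  have "(\<lambda>n. v (X n * Y n)) \<longlonglongrightarrow> nrm x * nrm y"
    using tendsto_mult[OF nrm_cls nrm_cls] X Y by simp
  then show ?thesis
    using LIMSEQ_unique nrm_cls[OF Cauchy_mult[OF X(1) Y(1)]] X Y by (simp add: cls_mult)
qed

lemma nrm_add_le:
  assumes "x \<in> carrier R" "y \<in> carrier R"
  shows "nrm (x \<oplus> y) \<le> max (nrm x) (nrm y)"
proof -
  obtain X Y where X: "padic_Cauchy p X" "x = cls X" and Y: "padic_Cauchy p Y" "y = cls Y"
    using assms cls_surj by metis
  have "(\<lambda>n. v (X n + Y n)) \<longlonglongrightarrow> nrm (x \<oplus> y)"
    using nrm_cls[OF Cauchy_add[OF X(1) Y(1)]] X Y by (simp add: cls_add)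
  moreover have "(\<lambda>n. max (v (X n)) (v (Y n))) \<longlonglongrightarrow> max (nrm x) (nrm y)"
    using tendsto_max[OF nrm_cls nrm_cls] X Y by simp
  ultimately show ?thesis
    by (rule LIMSEQ_le) (auto intro: v_add_le)
qed

lemma nrm_eq_0:
  assumes "x \<in> carrier R" "nrm x = 0"
  shows "x = \<zero>"
proof -
  obtain X where X: "padic_Cauchy p X" "x = cls X"
    using assms cls_surj by metis
  then have "(\<lambda>n. v (X n - 0)) \<longlonglongrightarrow> 0"
    using nrm_cls[OF X(1)] assms by simp
  then have "cls X = cls (\<lambda>_. 0)"
    using X by (intro cls_eqI) auto
  then show ?thesis
    using X \<iota>_0 by (simp add: \<iota>_cls)
qed

lemma nrm_diff_eq_0:
  assumes "x \<in> carrier R" "y \<in> carrier R" "nrm (x \<ominus> y) = 0"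
  shows "x = y"
proof -
  have "x = (x \<ominus> y) \<oplus> y"
    using assms(1,2) by (elim cls_surj) (simp add: cls_diff cls_add Cauchy_diff)
  then show ?thesis
    using nrm_eq_0[of "x \<ominus> y"] assms by simp
qed

lemma nrm_uminus:
  assumes "x \<in> carrier R"
  shows "nrm (\<ominus> x) = nrm x"
proof -
  have "\<ominus> x = \<iota> (- 1) \<otimes> x"
    using assms by (elim cls_surj) (simp add: \<iota>_cls cls_mult cls_uminus)
  then show ?thesis
    using assms by (simp add: nrm_mult)
qed

lemma nrm_diff_le:
  assumes "x \<in> carrier R" "y \<in> carrier R"
  shows "nrm (x \<ominus> y) \<le> max (nrm x) (nrm y)"
  using nrm_add_le[of x "\<ominus> y"] assms by (simp add: a_minus_def nrm_uminus)

lemma rat_dense: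
  assumes "x \<in> carrier R" "e > 0"
  obtains r where "nrm (x \<ominus> \<iota> r) \<le> e"
proof -
  obtain X where X: "padic_Cauchy p X" "x = cls X"
    using assms cls_surj by metis
  obtain M where M: "\<And>m n. m \<ge> M \<Longrightarrow> n \<ge> M \<Longrightarrow> v (X m - X n) < e"
    using X assms(2) unfolding padic_Cauchy_def by metis
  have "(\<lambda>n. v (X n - X M)) \<longlonglongrightarrow> nrm (x \<ominus> \<iota> (X M))"
    using X nrm_cls[of "\<lambda>n. X n - X M"] by (simp add: \<iota>_cls cls_diff Cauchy_diff)
  then have "nrm (x \<ominus> \<iota> (X M)) \<le> e"
    by (rule LIMSEQ_le_const2) (use M in \<open>auto intro!: exI[of _ M] less_imp_le\<close>)
  then show ?thesis
    using that by blast
qed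

section \<open>Rational affine maps\<close>

text \<open>
  The iteration, its inverse branches and the recursion for the digit series are all maps of this
  form. Their composition law \<open>aff_aff\<close> replaces most computations in the ring.
\<close>

definition aff :: "rat \<Rightarrow> rat \<Rightarrow> (nat \<Rightarrow> rat) set \<Rightarrow> (nat \<Rightarrow> rat) set" where
  "aff a b x = \<iota> a \<otimes> x \<oplus> \<iota> b"

lemma aff_closed [simp]: "x \<in> carrier R \<Longrightarrow> aff a b x \<in> carrier R"
  by (simp add: aff_def)

lemma aff_cls: "padic_Cauchy p X \<Longrightarrow> aff a b (cls X) = cls (\<lambda>n. a * X n + b)"
  by (simp add: aff_def \<iota>_cls cls_mult cls_add Cauchy_mult)

lemma aff_id [simp]: "x \<in> carrier R \<Longrightarrow> aff 1 0 x = x"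
  by (elim cls_surj) (simp add: aff_cls)

lemma aff_aff: "x \<in> carrier R \<Longrightarrow> aff a b (aff c d x) = aff (a * c) (a * d + b) x"
  by (elim cls_surj) (simp add: aff_cls Cauchy_mult Cauchy_add algebra_simps)

lemma aff_\<iota>: "aff a b (\<iota> r) = \<iota> (a * r + b)"
  by (simp add: aff_def \<iota>_mult \<iota>_add)

lemma Qp_divide_aff: "x \<in> carrier R \<Longrightarrow> a \<noteq> 0 \<Longrightarrow> Qp_divide p x (\<iota> a) = aff (1 / a) 0 x"
  by (simp add: Qp_divide_def \<iota>_inverse aff_def \<iota>_0 S.m_comm flip: R_def)

lemma aff_inj:
  assumes "x \<in> carrier R" "y \<in> carrier R" "aff a b x = aff a b y" "a \<noteq> 0"
  shows "x = y"
proof -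
  have "aff (1 / a) (- b / a) (aff a b x) = aff (1 / a) (- b / a) (aff a b y)"
    using assms by simp
  then show ?thesis
    using assms(1,2,4) by (simp add: aff_aff)
qed

lemma nrm_aff_diff:
  assumes "x \<in> carrier R" "y \<in> carrier R"
  shows "nrm (aff a b x \<ominus> aff a b y) = v a * nrm (x \<ominus> y)"
proof -
  have "aff a b x \<ominus> aff a b y = \<iota> a \<otimes> (x \<ominus> y)"
    using assms by (elim cls_surj)
      (simp add: aff_cls cls_diff cls_mult \<iota>_cls Cauchy_mult Cauchy_add Cauchy_diff algebra_simps)
  then show ?thesis
    using assms by (simp add: nrm_mult)
qed

lemma nrm_aff_le:
  assumes "x \<in> carrier R"
  shows "nrm (aff a b x) \<le> max (v a * nrm x) (v b)"
  using nrm_add_le[of "\<iota> a \<otimes> x" "\<iota> b"] assms by (simp add: aff_def nrm_mult)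

lemma aff_fixed_point_rational:
  assumes "x \<in> carrier R" "aff a b x = x" "a \<noteq> 1"
  shows "x \<in> Qp_Rats p"
proof -
  obtain X where X: "padic_Cauchy p X" "x = cls X"
    using assms cls_surj by metis
  then have "cls (\<lambda>n. a * X n + b) = cls X"
    using assms by (simp add: aff_cls)
  then have "(\<lambda>n. v (a * X n + b - X n)) \<longlonglongrightarrow> 0"
    using X by (simp add: cls_eq_iff Cauchy_mult Cauchy_add null_seqs_iff)
  moreover have "a * X n + b - X n = (a - 1) * (X n - b / (1 - a))" for n
    using assms(3) by (simp add: divide_simps) (simp add: algebra_simps)
  ultimately have "(\<lambda>n. v (a - 1) * v (X n - b / (1 - a))) \<longlonglongrightarrow> 0"
    by simp
  then have "(\<lambda>n. v (X n - b / (1 - a))) \<longlonglongrightarrow> 0"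
    using assms(3) tendsto_mult_left_iff[of "v (a - 1)" _ 0] by simp
  then have "x = \<iota> (b / (1 - a))"
    unfolding X(2) \<iota>_cls using X by (intro cls_eqI) auto
  then show ?thesis
    by (auto simp: Qp_Rats_def)
qed

section \<open>Digits\<close>

lemma Zp_iff: "x \<in> Zp p \<longleftrightarrow> x \<in> carrier R \<and> nrm x \<le> 1"
  by (simp add: Zp_def R_def)

lemma Zp_p_dvd_iff:
  "Zp_p_dvd p x \<longleftrightarrow> x \<in> carrier R \<and> nrm x \<le> 1 / real p"
proof
  assume "Zp_p_dvd p x"
  then obtain y where "y \<in> carrier R" "nrm y \<le> 1" "x = \<iota> (of_nat p) \<otimes> y"
    by (auto simp: Zp_p_dvd_def Zp_iff R_def)
  then show "x \<in> carrier R \<and> nrm x \<le> 1 / real p"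
    by (simp add: nrm_mult divide_right_mono)
next
  assume x: "x \<in> carrier R \<and> nrm x \<le> 1 / real p"
  define y where "y = aff (1 / of_nat p) 0 x"
  have "nrm y \<le> max (real p * nrm x) 0"
    using nrm_aff_le[of x "1 / of_nat p" 0] x by (simp add: y_def)
  also have "\<dots> \<le> 1"
    using x p_gt_1 by (auto simp: field_simps)
  finally have "nrm y \<le> 1" .
  moreover have "x = aff (of_nat p) 0 y"
    using x p_gt_1 by (simp add: y_def aff_aff)
  moreover have "y \<in> carrier R"
    using x by (simp add: y_def)
  ultimately show "Zp_p_dvd p x"
    by (auto simp: Zp_p_dvd_def Zp_iff aff_def \<iota>_0 simp flip: R_def)
qed

lemma digit_unique:
  assumes "x \<in> carrier R" "d \<in> {0..int p - 1}" "d' \<in> {0..int p - 1}"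
    and "nrm (x \<ominus> \<iota> (of_int d)) \<le> 1 / real p" "nrm (x \<ominus> \<iota> (of_int d')) \<le> 1 / real p"
  shows "d = d'"
proof -
  have "\<iota> (of_int (d' - d)) = (x \<ominus> \<iota> (of_int d)) \<ominus> (x \<ominus> \<iota> (of_int d'))"
    using assms(1) by (elim cls_surj) (simp add: \<iota>_cls cls_diff Cauchy_diff)
  then have "v (of_int (d' - d)) = nrm ((x \<ominus> \<iota> (of_int d)) \<ominus> (x \<ominus> \<iota> (of_int d')))"
    by (simp only: flip: nrm_\<iota>)
  also have "\<dots> \<le> max (nrm (x \<ominus> \<iota> (of_int d))) (nrm (x \<ominus> \<iota> (of_int d')))"
    using assms(1) by (intro nrm_diff_le) auto
  also have "\<dots> \<le> 1 / real p"
    using assms(4,5) by simp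
  finally have "v (of_int (d' - d)) \<le> 1 / real p" .
  then have "int p dvd d' - d"
    by (simp only: v_of_int_le_inverse_p_iff)
  moreover have "\<bar>d' - d\<bar> < int p"
    using assms by auto
  ultimately show ?thesis
    using dvd_imp_le_int[of "d' - d" "int p"] by (cases "d' = d") auto
qed

lemma eps0_eqI:
  assumes "x \<in> carrier R" "d \<in> {0..int p - 1}" "nrm (x \<ominus> \<iota> (of_int d)) \<le> 1 / real p"
  shows "eps0 p x = d"
  unfolding eps0_def
  using assms digit_unique[OF assms(1)]
  by (intro the_equality) (auto simp: Zp_p_dvd_iff simp flip: R_def)

text \<open>
  A digit of a rational number close enough to \<open>x\<close> is a digit of \<open>x\<close>.
\<close>

lemma eps0:
  assumes "x \<in> carrier R" "nrm x \<le> 1"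
  shows "eps0 p x \<in> {0..int p - 1}" "nrm (x \<ominus> \<iota> (of_int (eps0 p x))) \<le> 1 / real p"
proof -
  obtain r where r: "nrm (x \<ominus> \<iota> r) \<le> 1 / real p"
    by (rule rat_dense[OF assms(1), of "1 / real p"]) (use p_gt_1 in auto)
  have "\<iota> r = x \<ominus> (x \<ominus> \<iota> r)"
    using assms(1) by (elim cls_surj) (simp add: \<iota>_cls cls_diff Cauchy_diff)
  then have "v r = nrm (x \<ominus> (x \<ominus> \<iota> r))"
    by (simp only: flip: nrm_\<iota>)
  also have "\<dots> \<le> max (nrm x) (nrm (x \<ominus> \<iota> r))"
    using assms(1) by (intro nrm_diff_le) auto
  also have "\<dots> \<le> 1"
    using assms r p_gt_1 by (auto intro: order_trans)
  finally obtain d where d: "d \<in> {0..int p - 1}" "v (r - of_int d) \<le> 1 / real p"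
    using v_digit_exists by blast
  have "x \<ominus> \<iota> (of_int d) = (x \<ominus> \<iota> r) \<oplus> \<iota> (r - of_int d)"
    using assms(1) by (elim cls_surj) (simp add: \<iota>_cls cls_diff cls_add Cauchy_diff)
  then have "nrm (x \<ominus> \<iota> (of_int d)) \<le> 1 / real p"
    using nrm_add_le[of "x \<ominus> \<iota> r" "\<iota> (r - of_int d)"] r d assms by simp
  then have "eps0 p x = d"
    using assms d by (intro eps0_eqI)
  then show "eps0 p x \<in> {0..int p - 1}" "nrm (x \<ominus> \<iota> (of_int (eps0 p x))) \<le> 1 / real p"
    using d \<open>nrm (x \<ominus> \<iota> (of_int d)) \<le> 1 / real p\<close> by auto
qed


section \<open>Digit expansions\<close>

definition digit_sum :: "(nat \<Rightarrow> int) \<Rightarrow> (nat \<Rightarrow> rat) set" where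
  "digit_sum a = cls (\<lambda>N. \<Sum>n<N. of_int (a n) * of_nat p ^ n)"

lemma v_partial_sums_diff:
  assumes "N \<le> M"
  shows "v ((\<Sum>n<N. of_int (a n) * of_nat p ^ n) - (\<Sum>n<M. of_int (a n) * of_nat p ^ n)) \<le> (1 / real p) ^ N"
proof -
  have "(\<Sum>n<M. of_int (a n) * of_nat p ^ n :: rat) - (\<Sum>n<N. of_int (a n) * of_nat p ^ n) =
      (\<Sum>n\<in>{N..<M}. of_int (a n) * of_nat p ^ n)"
    using assms by (simp add: sum_diff_nat_ivl lessThan_atLeast0)
  also have "\<dots> = of_nat p ^ N * of_int (\<Sum>n\<in>{N..<M}. a n * int p ^ (n - N))"
    by (auto simp: sum_distrib_left power_add[symmetric] intro!: sum.cong)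
  finally have "v ((\<Sum>n<N. of_int (a n) * of_nat p ^ n) - (\<Sum>n<M. of_int (a n) * of_nat p ^ n)) =
      (1 / real p) ^ N * v (of_int (\<Sum>n\<in>{N..<M}. a n * int p ^ (n - N)))"
    by (subst v_minus_commute) (simp del: of_int_sum)
  also have "\<dots> \<le> (1 / real p) ^ N * 1"
    by (intro mult_left_mono v_of_int_le_1) auto
  finally show ?thesis
    by simp
qed

lemma inverse_p_power_tendsto_0: "(\<lambda>N. (1 / real p) ^ N) \<longlonglongrightarrow> 0"
  using p_gt_1 by (intro LIMSEQ_power_zero) auto

lemma Cauchy_partial_sums: "padic_Cauchy p (\<lambda>N. \<Sum>n<N. of_int (a n) * of_nat p ^ n)"
  (is "padic_Cauchy p ?S")
  unfolding padic_Cauchy_def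
proof (intro allI impI)
  fix e :: real assume "e > 0"
  then obtain K where K: "(1 / real p) ^ K < e"
    using p_gt_1 real_arch_pow_inv[of e "1 / real p"] by auto
  have "v (?S m - ?S n) < e" if "m \<ge> K" "n \<ge> K" for m n
  proof -
    have "v (?S m - ?S n) = v ((?S K - ?S n) - (?S K - ?S m))"
      by (simp add: algebra_simps)
    also have "\<dots> \<le> (1 / real p) ^ K"
      using v_diff_le v_partial_sums_diff that by (meson max.boundedI order_trans)
    finally show ?thesis
      using K by simp
  qed
  then show "\<exists>M. \<forall>m\<ge>M. \<forall>n\<ge>M. v (?S m - ?S n) < e"
    by blast
qed

lemma digit_sum_closed [simp]: "digit_sum a \<in> carrier R"
  by (simp add: digit_sum_def Cauchy_partial_sums)

lemma nrm_partial_sum_diff: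
  "nrm (\<iota> (\<Sum>n<N. of_int (a n) * of_nat p ^ n) \<ominus> digit_sum a) \<le> (1 / real p) ^ N"
proof -
  let ?S = "\<lambda>N. \<Sum>n<N. of_int (a n) * of_nat p ^ n"
  have "(\<lambda>M. v (?S N - ?S M)) \<longlonglongrightarrow> nrm (\<iota> (?S N) \<ominus> digit_sum a)"
    using nrm_cls[of "\<lambda>M. ?S N - ?S M"]
    by (simp add: digit_sum_def \<iota>_cls cls_diff Cauchy_partial_sums Cauchy_diff)
  then show ?thesis
    by (rule LIMSEQ_le_const2) (use v_partial_sums_diff in blast)
qed

text \<open>
  The partial sums are rational and form a Cauchy sequence, so their class is the value of the
  series: by the ultrametric inequality, the class is within \<open>p\<^sup>-\<^sup>N\<close> of the \<open>N\<close>-th partial sum.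
\<close>

lemma Qp_sums_iff:
  "Qp_sums p (\<lambda>n. \<iota> (of_int (a n)) \<otimes> \<iota> (of_nat p) [^] n) s \<longleftrightarrow> s = digit_sum a"
proof -
  let ?S = "\<lambda>N. \<Sum>n<N. of_int (a n) * of_nat p ^ n"
  have sum: "(\<Oplus>n\<in>{..<N}. \<iota> (of_int (a n)) \<otimes> \<iota> (of_nat p) [^] n) = \<iota> (?S N)" for N
    by (simp add: \<iota>_power \<iota>_mult \<iota>_sum)
  have lim: "(\<lambda>N. nrm (\<iota> (?S N) \<ominus> digit_sum a)) \<longlonglongrightarrow> 0"
    by (rule tendsto_sandwich[where f = "\<lambda>_. 0", OF _ _ _ inverse_p_power_tendsto_0])
      (auto intro!: always_eventually nrm_nonneg nrm_partial_sum_diff)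
  have "s = digit_sum a" if "s \<in> carrier R" "(\<lambda>N. nrm (\<iota> (?S N) \<ominus> s)) \<longlonglongrightarrow> 0" for s
  proof (rule nrm_diff_eq_0)
    have "nrm (s \<ominus> digit_sum a) \<le> max (nrm (\<iota> (?S N) \<ominus> digit_sum a)) (nrm (\<iota> (?S N) \<ominus> s))" for N
    proof -
      have "s \<ominus> digit_sum a = (\<iota> (?S N) \<ominus> digit_sum a) \<ominus> (\<iota> (?S N) \<ominus> s)"
        using that(1) unfolding digit_sum_def
        by (elim cls_surj) (simp add: \<iota>_cls cls_diff Cauchy_diff Cauchy_partial_sums)
      then show ?thesis
        using nrm_diff_le[of "\<iota> (?S N) \<ominus> digit_sum a" "\<iota> (?S N) \<ominus> s"] that(1) by simp
    qed
    then have "nrm (s \<ominus> digit_sum a) \<le> 0"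
      using tendsto_max[OF lim that(2)] by (intro LIMSEQ_le_const) auto
    then show "nrm (s \<ominus> digit_sum a) = 0"
      using that(1) nrm_nonneg[of "s \<ominus> digit_sum a"] by simp
  qed (use that in auto)
  then show ?thesis
    using lim unfolding Qp_sums_def R_def[symmetric] sum by auto
qed

lemma nrm_digit_sum_diff: "nrm (digit_sum a \<ominus> \<iota> (of_int (a 0))) \<le> 1 / real p"
proof -
  have "digit_sum a \<ominus> \<iota> (of_int (a 0)) = \<ominus> (\<iota> (of_int (a 0)) \<ominus> digit_sum a)"
    by (simp add: \<iota>_cls digit_sum_def cls_diff cls_uminus Cauchy_partial_sums Cauchy_diff)
  then show ?thesis
    using nrm_partial_sum_diff[of a 1] by (simp add: nrm_uminus lessThan_Suc)
qed

lemma nrm_digit_sum_le: "nrm (digit_sum a) \<le> 1"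
proof -
  have "digit_sum a = (digit_sum a \<ominus> \<iota> (of_int (a 0))) \<oplus> \<iota> (of_int (a 0))"
    by (simp add: \<iota>_cls digit_sum_def cls_diff cls_add Cauchy_partial_sums Cauchy_diff)
  then have "nrm (digit_sum a) \<le> max (nrm (digit_sum a \<ominus> \<iota> (of_int (a 0)))) (v (of_int (a 0)))"
    using nrm_add_le[of "digit_sum a \<ominus> \<iota> (of_int (a 0))" "\<iota> (of_int (a 0))"] by simp
  also have "\<dots> \<le> 1"
    using order_trans[OF nrm_digit_sum_diff[of a], of 1] p_gt_1 by simp
  finally show ?thesis .
qed

text \<open>
  Applying the affine map to the partial sums of the shifted series gives the partial sums of the
  original series with the index moved by one, which represent the same p-adic number.
\<close>

lemma digit_sum_rec:
  "digit_sum a = aff (of_nat p) (of_int (a 0)) (digit_sum (\<lambda>n. a (Suc n)))"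
proof -
  let ?S = "\<lambda>a N. \<Sum>n<N. of_int (a n) * of_nat p ^ n :: rat"
  have "of_nat p * ?S (\<lambda>n. a (Suc n)) N + of_int (a 0) = ?S a (Suc N)" for N
    by (simp only: sum.lessThan_Suc_shift) (simp add: sum_distrib_left mult_ac)
  then have "aff (of_nat p) (of_int (a 0)) (digit_sum (\<lambda>n. a (Suc n))) =
      cls (\<lambda>N. ?S a (Suc N))"
    unfolding digit_sum_def by (simp only: aff_cls[OF Cauchy_partial_sums])
  also have "\<dots> = digit_sum a"
    unfolding digit_sum_def
  proof (rule cls_eqI)
    show "padic_Cauchy p (\<lambda>N. ?S a (Suc N))"
      using Cauchy_partial_sums[of a] unfolding padic_Cauchy_def by (meson le_Suc_eq)
    show "(\<lambda>N. v (?S a (Suc N) - ?S a N)) \<longlonglongrightarrow> 0"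
    proof (rule tendsto_sandwich[where f = "\<lambda>_. 0", OF _ _ _ inverse_p_power_tendsto_0])
      show "\<forall>\<^sub>F N in sequentially. v (?S a (Suc N) - ?S a N) \<le> (1 / real p) ^ N"
        by (auto intro!: always_eventually mult_left_le_one_le)
    qed auto
  qed (rule Cauchy_partial_sums)
  finally show ?thesis ..
qed

end

section \<open>The map on the p-adic integers\<close>

locale padic_map = padic +
  fixes q :: int
  assumes coprime_q: "coprime q (int p)" and q_nz: "q \<noteq> 0"
begin

abbreviation g where "g \<equiv> gmap p q"

definition digit :: "(nat \<Rightarrow> rat) set \<Rightarrow> int" where
  "digit x = eps0 p (\<ominus> (\<iota> (of_int q) \<otimes> x))"

lemma nrm_neg_q: "x \<in> carrier R \<Longrightarrow> nrm (\<ominus> (\<iota> (of_int q) \<otimes> x)) = nrm x"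
  by (simp add: nrm_uminus nrm_mult v_of_int_coprime coprime_q)

lemma digit_range:
  assumes "x \<in> Zp p"
  shows "digit x \<in> {0..int p - 1}"
  using eps0(1)[of "\<ominus> (\<iota> (of_int q) \<otimes> x)"] assms by (simp add: digit_def Zp_iff nrm_neg_q)

lemma nrm_digit:
  assumes "x \<in> Zp p"
  shows "nrm (aff (of_int q) (of_int (digit x)) x) \<le> 1 / real p"
proof -
  have x: "x \<in> carrier R"
    using assms by (simp add: Zp_iff)
  have "aff (of_int q) (of_int (digit x)) x =
      \<ominus> (\<ominus> (\<iota> (of_int q) \<otimes> x) \<ominus> \<iota> (of_int (digit x)))"
    using x by (elim cls_surj)
      (simp add: aff_cls \<iota>_cls cls_mult cls_uminus cls_diff Cauchy_mult Cauchy_uminus Cauchy_diff add.commute)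
  moreover have "nrm (\<ominus> (\<iota> (of_int q) \<otimes> x) \<ominus> \<iota> (of_int (digit x))) \<le> 1 / real p"
    unfolding digit_def using assms x by (intro eps0(2)) (simp_all add: nrm_neg_q Zp_iff)
  ultimately show ?thesis
    using x by (simp add: nrm_uminus)
qed

lemma digit_eq_0_iff:
  assumes "x \<in> Zp p"
  shows "digit x = 0 \<longleftrightarrow> Zp_p_dvd p x"
proof
  have x: "x \<in> carrier R"
    using assms by (simp add: Zp_iff)
  {
    assume "digit x = 0"
    then have "nrm (\<iota> (of_int q) \<otimes> x) \<le> 1 / real p"
      using nrm_digit[OF assms] x by (simp add: aff_def \<iota>_0)
    then show "Zp_p_dvd p x"
      using x by (simp add: nrm_mult Zp_p_dvd_iff v_of_int_coprime coprime_q)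
  next
    assume "Zp_p_dvd p x"
    then have "nrm (\<ominus> (\<iota> (of_int q) \<otimes> x)) \<le> 1 / real p"
      using x by (simp add: nrm_neg_q Zp_p_dvd_iff)
    then show "digit x = 0"
      unfolding digit_def using x p_gt_1 by (intro eps0_eqI) (auto simp: \<iota>_0 a_minus_def)
  }
qed

text \<open>
  The factor in the step \<open>x \<mapsto> (slope d * x + d) / p\<close>: since \<open>q\<close> is a unit, the digit is \<open>0\<close>
  exactly if \<open>p\<close> divides \<open>x\<close>, so the digit alone selects the branch of the iteration.
\<close>

definition slope :: "int \<Rightarrow> rat" where
  "slope d = (if d = 0 then 1 else of_int q)"

lemma slope_nz: "slope d \<noteq> 0"
  using q_nz by (simp add: slope_def)

lemma v_slope [simp]: "v (slope d) = 1"
  by (simp add: slope_def v_of_int_coprime coprime_q)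

lemma g_aff:
  assumes "x \<in> Zp p"
  shows "g x = aff (slope (digit x) / of_nat p) (of_int (digit x) / of_nat p) x"
proof -
  have x: "x \<in> carrier R"
    using assms by (simp add: Zp_iff)
  have "g x = Qp_divide p (aff (slope (digit x)) (of_int (digit x)) x) (\<iota> (of_nat p))"
  proof (cases "digit x = 0")
    case True
    then show ?thesis
      using digit_eq_0_iff[OF assms] x by (simp add: gmap_def slope_def)
  next
    case False
    then show ?thesis
      using digit_eq_0_iff[OF assms] unfolding gmap_def R_def[symmetric] digit_def[symmetric]
      by (simp add: slope_def aff_def)
  qed
  also have "\<dots> = aff (1 / of_nat p) 0 (aff (slope (digit x)) (of_int (digit x)) x)"
    using x p_gt_1 by (simp add: Qp_divide_aff)
  also have "\<dots> = aff (slope (digit x) / of_nat p) (of_int (digit x) / of_nat p) x"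
    using x by (simp add: aff_aff)
  finally show ?thesis .
qed

lemma g_inverse:
  assumes "x \<in> Zp p"
  shows "x = aff (of_nat p / slope (digit x)) (- of_int (digit x) / slope (digit x)) (g x)"
  using assms p_gt_1 slope_nz[of "digit x"] by (simp add: g_aff aff_aff Zp_iff)

lemma g_Zp:
  assumes "x \<in> Zp p"
  shows "g x \<in> Zp p"
proof -
  have x: "x \<in> carrier R"
    using assms by (simp add: Zp_iff)
  have "nrm (aff (slope (digit x)) (of_int (digit x)) x) \<le> 1 / real p"
  proof (cases "digit x = 0")
    case True
    then show ?thesis
      using digit_eq_0_iff[OF assms] x by (simp add: slope_def Zp_p_dvd_iff)
  next
    case False
    then show ?thesis
      using nrm_digit[OF assms] by (simp add: slope_def)
  qed
  moreover have "g x = aff (1 / of_nat p) 0 (aff (slope (digit x)) (of_int (digit x)) x)"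
    using x by (simp add: g_aff[OF assms] aff_aff)
  moreover from this have "nrm (g x) = real p * nrm (aff (slope (digit x)) (of_int (digit x)) x)"
    using x by (simp add: aff_def[of "1 / of_nat p" 0] \<iota>_0 nrm_mult)
  ultimately show ?thesis
    using p_gt_1 x by (simp add: Zp_iff field_simps)
qed

lemma g_iter_Zp: "x \<in> Zp p \<Longrightarrow> (g ^^ n) x \<in> Zp p"
  by (induction n) (auto simp: g_Zp)

abbreviation phi0 where "phi0 \<equiv> phi_Zp p q"

lemma phi0_eq: "phi0 u = digit_sum (\<lambda>n. digit ((g ^^ n) u))"
proof -
  have "phi0 u = (THE s. s = digit_sum (\<lambda>n. digit ((g ^^ n) u)))"
    unfolding phi_Zp_def R_def[symmetric] digit_def[symmetric] of_int_of_nat_eq Qp_sums_iff ..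
  then show ?thesis
    by simp
qed

lemma phi0_Zp: "phi0 u \<in> Zp p"
  by (simp add: phi0_eq Zp_iff nrm_digit_sum_le)

lemma phi0_rec: "phi0 u = aff (of_nat p) (of_int (digit u)) (phi0 (g u))"
  using digit_sum_rec[of "\<lambda>n. digit ((g ^^ n) u)"]
  unfolding phi0_eq funpow_Suc_right o_apply by (simp only: funpow_0)

lemma nrm_phi0_diff_digit: "nrm (phi0 u \<ominus> \<iota> (of_int (digit u))) \<le> 1 / real p"
  using nrm_digit_sum_diff[of "\<lambda>n. digit ((g ^^ n) u)"] by (simp add: phi0_eq)

text \<open>
  The digit of \<open>u\<close> is the residue of \<open>phi0 u\<close> modulo \<open>p\<close>; removing it and dividing by \<open>p\<close> leaves
  the value at the next iterate.
\<close>

lemma phi0_eq_imp: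
  assumes "u \<in> Zp p" "w \<in> Zp p" "phi0 u = phi0 w"
  shows "digit u = digit w" "phi0 (g u) = phi0 (g w)"
proof -
  show d: "digit u = digit w"
    by (rule digit_unique[of "phi0 u"])
      (use nrm_phi0_diff_digit[of u] nrm_phi0_diff_digit[of w] assms phi0_Zp[of u] digit_range
        in \<open>auto simp: Zp_iff\<close>)
  show "phi0 (g u) = phi0 (g w)"
  proof (rule aff_inj)
    show "aff (of_nat p) (of_int (digit w)) (phi0 (g u)) = aff (of_nat p) (of_int (digit w)) (phi0 (g w))"
      using assms(3) phi0_rec[of u] phi0_rec[of w] d by simp
  qed (use phi0_Zp p_gt_1 in \<open>auto simp: Zp_iff\<close>)
qed

text \<open>
  Equal values have equal digits, so both arguments run through the same inverse branches, each of
  which shrinks their distance by the factor \<open>1 / p\<close>.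
\<close>

lemma phi0_inj:
  assumes "u \<in> Zp p" "w \<in> Zp p" "phi0 u = phi0 w"
  shows "u = w"
proof -
  have "nrm (u \<ominus> w) \<le> (1 / real p) ^ n" for n
    using assms
  proof (induction n arbitrary: u w)
    case 0
    then show ?case
      using nrm_diff_le[of u w] by (auto simp: Zp_iff)
  next
    case (Suc n)
    note d = phi0_eq_imp[OF Suc.prems]
    let ?h = "aff (of_nat p / slope (digit w)) (- of_int (digit w) / slope (digit w))"
    have "u = ?h (g u)"
      using g_inverse[OF Suc.prems(1)] d(1) by simp
    moreover have "w = ?h (g w)"
      using g_inverse[OF Suc.prems(2)] .
    ultimately have "nrm (u \<ominus> w) = nrm (?h (g u) \<ominus> ?h (g w))"
      by (rule arg_cong2)
    also have "\<dots> = 1 / real p * nrm (g u \<ominus> g w)"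
      using g_Zp Suc.prems by (simp add: nrm_aff_diff Zp_iff)
    also have "\<dots> \<le> 1 / real p * (1 / real p) ^ n"
      using Suc.IH[of "g u" "g w"] Suc.prems d(2) g_Zp by (intro mult_left_mono) auto
    finally show ?case
      by simp
  qed
  then have "nrm (u \<ominus> w) \<le> 0"
    by (intro LIMSEQ_le_const[OF inverse_p_power_tendsto_0]) simp
  then show ?thesis
    by (intro nrm_diff_eq_0) (use assms nrm_nonneg[of "u \<ominus> w"] in \<open>auto simp: Zp_iff\<close>)
qed

section \<open>The extension to the field\<close>

text \<open>
  Since \<open>p u\<close> has digit \<open>0\<close> and next iterate \<open>u\<close>, this is one step of the recursion for \<open>phi0\<close>.
\<close>

lemma phi0_mult_p:
  assumes "u \<in> Zp p"
  shows "phi0 (aff (of_nat p) 0 u) = aff (of_nat p) 0 (phi0 u)"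
proof -
  let ?w = "aff (of_nat p) 0 u"
  have u: "u \<in> carrier R" "nrm u \<le> 1"
    using assms by (auto simp: Zp_iff)
  have nw: "nrm ?w \<le> 1 / real p"
    using u by (simp add: aff_def \<iota>_0 nrm_mult divide_right_mono)
  then have w: "?w \<in> Zp p"
    using u p_gt_1 order_trans[OF nw, of 1] by (simp add: Zp_iff)
  have d: "digit ?w = 0"
    using digit_eq_0_iff[OF w] nw u by (simp add: Zp_p_dvd_iff)
  then have "g ?w = u"
    using g_aff[OF w] u p_gt_1 by (simp add: slope_def aff_aff)
  then show ?thesis
    using phi0_rec[of ?w] d by simp
qed

lemma Zp_aff_p_power:
  assumes "u \<in> Zp p"
  shows "aff (of_nat p ^ k) 0 u \<in> Zp p"
proof -
  have "(1 / real p) ^ k * nrm u \<le> 1 * 1"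
    using assms p_gt_1 by (intro mult_mono power_le_one) (auto simp: Zp_iff nrm_nonneg)
  then show ?thesis
    using assms by (simp add: Zp_iff aff_def \<iota>_0 nrm_mult)
qed

lemma phi0_mult_p_power:
  assumes "u \<in> Zp p"
  shows "phi0 (aff (of_nat p ^ k) 0 u) = aff (of_nat p ^ k) 0 (phi0 u)"
proof (induction k)
  case (Suc k)
  have "aff (of_nat p ^ Suc k) 0 u = aff (of_nat p) 0 (aff (of_nat p ^ k) 0 u)"
    using assms by (simp add: aff_aff Zp_iff)
  then have "phi0 (aff (of_nat p ^ Suc k) 0 u) = aff (of_nat p) 0 (phi0 (aff (of_nat p ^ k) 0 u))"
    using phi0_mult_p[OF Zp_aff_p_power[OF assms]] by simp
  then show ?case
    using phi0_Zp[of u] by (simp add: Suc.IH aff_aff Zp_iff)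
qed (use assms phi0_Zp in \<open>simp add: Zp_iff\<close>)

text \<open>
  Two representations of the same p-adic number differ by a power of \<open>p\<close> in the integral part, and
  \<open>phi0\<close> commutes with multiplication by that power.
\<close>

lemma phi_well_defined:
  assumes "u \<in> Zp p" "w \<in> Zp p" "n \<le> m"
    and "aff (1 / of_nat p ^ n) 0 u = aff (1 / of_nat p ^ m) 0 w"
  shows "aff (1 / of_nat p ^ n) 0 (phi0 u) = aff (1 / of_nat p ^ m) 0 (phi0 w)"
proof -
  have pow: "(of_nat p ^ m :: rat) = of_nat p ^ (m - n) * of_nat p ^ n" "of_nat p \<noteq> (0 :: rat)"
    using assms(3) p_gt_1 by (auto simp flip: power_add)
  have "w = aff (of_nat p ^ m) 0 (aff (1 / of_nat p ^ m) 0 w)"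
    using assms(2) p_gt_1 by (simp add: aff_aff Zp_iff)
  also have "\<dots> = aff (of_nat p ^ m) 0 (aff (1 / of_nat p ^ n) 0 u)"
    using assms(4) by simp
  also have "\<dots> = aff (of_nat p ^ (m - n)) 0 u"
    using assms(1) pow by (simp add: aff_aff Zp_iff)
  finally have "phi0 w = aff (of_nat p ^ (m - n)) 0 (phi0 u)"
    using phi0_mult_p_power[OF assms(1)] by simp
  then show ?thesis
    using phi0_Zp[of u] pow by (simp add: aff_aff Zp_iff)
qed

lemma phi_scale:
  assumes "u \<in> Zp p"
  shows "phi p q (aff (1 / of_nat p ^ n) 0 u) = aff (1 / of_nat p ^ n) 0 (phi0 u)"
proof -
  have div: "Qp_divide p w (\<iota> (of_nat p) [^] m) = aff (1 / of_nat p ^ m) 0 w"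
    if "w \<in> Zp p" for w and m :: nat
    using that p_gt_1 by (simp add: \<iota>_power Qp_divide_aff Zp_iff)
  show ?thesis
    unfolding phi_def R_def[symmetric] of_int_of_nat_eq
  proof (rule the_equality)
    show "\<forall>m::nat. \<forall>w\<in>Zp p.
      aff (1 / of_nat p ^ n) 0 u = Qp_divide p w (\<iota> (of_nat p) [^] m) \<longrightarrow>
      aff (1 / of_nat p ^ n) 0 (phi0 u) = Qp_divide p (phi0 w) (\<iota> (of_nat p) [^] m)"
    proof (intro allI ballI impI)
      fix m :: nat and w
      assume "w \<in> Zp p" "aff (1 / of_nat p ^ n) 0 u = Qp_divide p w (\<iota> (of_nat p) [^] m)"
      then show "aff (1 / of_nat p ^ n) 0 (phi0 u) = Qp_divide p (phi0 w) (\<iota> (of_nat p) [^] m)"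
        using phi_well_defined[of u w n m] phi_well_defined[of w u m n] assms phi0_Zp
        by (cases "n \<le> m") (simp_all add: div)
    qed
  next
    fix y
    assume "\<forall>m::nat. \<forall>w\<in>Zp p.
      aff (1 / of_nat p ^ n) 0 u = Qp_divide p w (\<iota> (of_nat p) [^] m) \<longrightarrow>
      y = Qp_divide p (phi0 w) (\<iota> (of_nat p) [^] m)"
    then have "aff (1 / of_nat p ^ n) 0 u = Qp_divide p u (\<iota> (of_nat p) [^] n) \<longrightarrow>
        y = Qp_divide p (phi0 u) (\<iota> (of_nat p) [^] n)"
      using assms by blast
    then show "y = aff (1 / of_nat p ^ n) 0 (phi0 u)"
      by (simp add: div assms phi0_Zp)
  qed
qed

lemma Qp_scale:
  assumes "x \<in> carrier R"
  obtains n u where "u \<in> Zp p" "x = aff (1 / of_nat p ^ n) 0 u"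
proof -
  obtain n where n: "nrm x < real p ^ n"
    using real_arch_pow p_gt_1 by (metis of_nat_1 of_nat_less_iff)
  define u where "u = aff (of_nat p ^ n) 0 x"
  have "nrm u \<le> 1"
    using n assms p_gt_1 by (simp add: u_def aff_def \<iota>_0 nrm_mult field_simps)
  then have "u \<in> Zp p"
    using assms by (simp add: Zp_iff u_def)
  moreover have "x = aff (1 / of_nat p ^ n) 0 u"
    using assms p_gt_1 by (simp add: u_def aff_aff)
  ultimately show ?thesis
    using that by blast
qed

section \<open>Rational values come from rational arguments\<close>

lemma aff_rational: "x \<in> Qp_Rats p \<Longrightarrow> aff a b x \<in> Qp_Rats p"
  by (auto simp: Qp_Rats_def aff_\<iota>)

lemma g_iter_inverse:
  assumes "u \<in> Zp p"
  shows "\<exists>a b. v a = (1 / real p) ^ k \<and> u = aff a b ((g ^^ k) u)"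
  using assms
proof (induction k arbitrary: u)
  case 0
  then show ?case
    by (intro exI[of _ 1] exI[of _ 0]) (simp add: Zp_iff)
next
  case (Suc k)
  obtain a b where ab: "v a = (1 / real p) ^ k" "g u = aff a b ((g ^^ k) (g u))"
    using Suc.IH[OF g_Zp[OF Suc.prems]] by blast
  let ?c = "of_nat p / slope (digit u)" and ?d = "- of_int (digit u) / slope (digit u)"
  have "u = aff ?c ?d (aff a b ((g ^^ k) (g u)))"
    using g_inverse[OF Suc.prems] ab(2) by simp
  also have "\<dots> = aff (?c * a) (?c * b + ?d) ((g ^^ k) (g u))"
    using g_iter_Zp[OF g_Zp[OF Suc.prems]] by (intro aff_aff) (auto simp: Zp_iff)
  finally have "u = aff (?c * a) (?c * b + ?d) ((g ^^ Suc k) u)"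
    by (simp add: funpow_Suc_right del: funpow.simps(2))
  moreover have "v (?c * a) = (1 / real p) ^ Suc k"
    using ab(1) by simp
  ultimately show ?case
    by blast
qed

text \<open>
  Running the inverse branches through one period gives an affine map with fixed point
  \<open>(g ^^ n) u\<close>. Its leading coefficient has absolute value below 1, so it is not 1.
\<close>

lemma periodic_imp_rational:
  assumes "u \<in> Zp p" "n < m" "(g ^^ n) u = (g ^^ m) u"
  shows "u \<in> Qp_Rats p"
proof -
  let ?w = "(g ^^ n) u"
  have w: "?w \<in> Zp p"
    using g_iter_Zp[OF assms(1)] .
  obtain a b where ab: "v a = (1 / real p) ^ (m - n)" "?w = aff a b ((g ^^ (m - n)) ?w)"
    using g_iter_inverse[OF w] by blast
  have "(g ^^ (m - n)) ?w = (g ^^ (m - n + n)) u"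
    by (simp only: funpow_add o_apply)
  then have "(g ^^ (m - n)) ?w = ?w"
    using assms(2,3) by simp
  then have "aff a b ?w = ?w"
    using ab(2) by simp
  moreover have "a \<noteq> 1"
  proof
    assume "a = 1"
    moreover have "(1 / real p) ^ (m - n) < 1"
      using assms(2) p_gt_1 by (intro power_Suc_less_one power_less_one_iff[THEN iffD2]) auto
    ultimately show False
      using ab(1) by simp
  qed
  ultimately have "?w \<in> Qp_Rats p"
    using aff_fixed_point_rational w by (simp add: Zp_iff)
  then show ?thesis
    using g_iter_inverse[OF assms(1), of n] aff_rational by metis
qed

text \<open>
  What is left of a number \<open>s\<close> after its first digits are split off; for \<open>s = phi0 u\<close> and the
  digits \<open>D\<close> of \<open>u\<close> these are the values of \<open>phi0\<close> at the iterates of \<open>u\<close>.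
\<close>

fun remainder :: "(nat \<Rightarrow> int) \<Rightarrow> rat \<Rightarrow> nat \<Rightarrow> rat" where
  "remainder D s 0 = s"
| "remainder D s (Suc n) = (remainder D s n - of_int (D n)) / of_nat p"

text \<open>
  Each remainder is p-adically integral, so the division by \<open>p\<close> never adds a factor \<open>p\<close> to the
  denominator: all remainders are \<open>t / b\<close> with \<open>b\<close> the denominator of \<open>s\<close>. The numerators stay in
  the interval \<open>{- B..B}\<close>, because \<open>B + b * (p - 1) \<le> p * B\<close> as soon as \<open>b \<le> B\<close>.
\<close>

lemma remainder_finite:
  assumes "\<And>n. v (remainder D s n) \<le> 1" "\<And>n. D n \<in> {0..int p - 1}"
  shows "finite (range (remainder D s))"
proof -
  obtain a b where s: "s = of_int a / of_int b" "b > 0"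
    using rat_fraction by metis
  define B where "B = max \<bar>a\<bar> b"
  have "\<exists>t. remainder D s n = of_int t / of_int b \<and> \<bar>t\<bar> \<le> B" for n
  proof (induction n)
    case 0
    then show ?case
      using s by (auto simp: B_def)
  next
    case (Suc n)
    then obtain t where t: "remainder D s n = of_int t / of_int b" "\<bar>t\<bar> \<le> B"
      by blast
    have "of_int (t - b * D n) = of_nat p * of_int b * remainder D s (Suc n)"
      using t(1) s(2) p_gt_1 by (simp add: field_simps)
    then have "v (of_int (t - b * D n)) = 1 / real p * (v (of_int b) * v (remainder D s (Suc n)))"
      by (simp only: v_mult v_p mult.assoc)
    also have "\<dots> \<le> 1 / real p * (1 * 1)"
      using assms(1)[of "Suc n"] by (intro mult_left_mono mult_mono) auto
    finally have "int p dvd t - b * D n"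
      by (simp only: v_of_int_le_inverse_p_iff mult_1_right)
    then obtain t' where t': "t - b * D n = int p * t'" ..
    have "int p * \<bar>t'\<bar> = \<bar>t - b * D n\<bar>"
      by (simp add: t' abs_mult)
    also have "\<dots> \<le> \<bar>t\<bar> + b * D n"
      using s(2) assms(2)[of n] by (intro order_trans[OF abs_triangle_ineq4]) (simp add: abs_mult)
    also have "\<dots> \<le> B + B * (int p - 1)"
      using s(2) assms(2)[of n] t(2) by (intro add_mono mult_mono) (auto simp: B_def)
    also have "\<dots> = int p * B"
      by (simp add: algebra_simps)
    finally have "\<bar>t'\<bar> \<le> B"
      using p_gt_1 by simp
    moreover have "remainder D s (Suc n) = of_int (t - b * D n) / (of_nat p * of_int b)"
      using t(1) s(2) p_gt_1 by (simp add: field_simps)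
    then have "remainder D s (Suc n) = of_int t' / of_int b"
      using p_gt_1 unfolding t' by simp
    ultimately show ?case
      by blast
  qed
  then have "range (remainder D s) \<subseteq> (\<lambda>t. of_int t / of_int b) ` {- B..B}"
    by (fastforce simp: abs_le_iff)
  then show ?thesis
    by (rule finite_subset) auto
qed

lemma phi0_rational_imp:
  assumes "u \<in> Zp p" "phi0 u \<in> Qp_Rats p"
  shows "u \<in> Qp_Rats p"
proof -
  obtain s where s: "phi0 u = \<iota> s"
    using assms(2) by (auto simp: Qp_Rats_def)
  define D where "D = (\<lambda>n. digit ((g ^^ n) u))"
  have r: "phi0 ((g ^^ n) u) = \<iota> (remainder D s n)" for n
  proof (induction n)
    case (Suc n)
    have "aff (of_nat p) (of_int (D n)) (phi0 ((g ^^ Suc n) u)) = \<iota> (remainder D s n)"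
      using phi0_rec[of "(g ^^ n) u"] Suc.IH by (simp add: D_def)
    also have "\<dots> = aff (of_nat p) (of_int (D n)) (\<iota> (remainder D s (Suc n)))"
      using p_gt_1 by (simp add: aff_\<iota>)
    finally show ?case
      by (rule aff_inj[rotated 2]) (use phi0_Zp p_gt_1 in \<open>auto simp: Zp_iff\<close>)
  qed (simp add: s)
  have "v (remainder D s n) \<le> 1" for n
    using phi0_Zp[of "(g ^^ n) u"] by (simp add: r Zp_iff)
  then have "finite (range (remainder D s))"
    by (rule remainder_finite) (unfold D_def, intro digit_range g_iter_Zp assms(1))
  then have "\<not> inj (remainder D s)"
    using finite_imageD[of "remainder D s" UNIV] infinite_UNIV_nat by blast
  then obtain n m where "n < m" "remainder D s n = remainder D s m"
    by (meson linorder_injI)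
  then have "phi0 ((g ^^ n) u) = phi0 ((g ^^ m) u)"
    by (simp add: r)
  then have "(g ^^ n) u = (g ^^ m) u"
    by (rule phi0_inj[OF g_iter_Zp[OF assms(1)] g_iter_Zp[OF assms(1)]])
  then show ?thesis
    using periodic_imp_rational assms(1) \<open>n < m\<close> by blast
qed

lemma phi_rational_imp:
  assumes "x \<in> carrier R" "phi p q x \<in> Qp_Rats p"
  shows "x \<in> Qp_Rats p"
proof -
  obtain n u where u: "u \<in> Zp p" "x = aff (1 / of_nat p ^ n) 0 u"
    using Qp_scale[OF assms(1)] .
  have "phi0 u = aff (of_nat p ^ n) 0 (phi p q x)"
    using phi0_Zp[of u] p_gt_1 by (simp add: u(2) phi_scale[OF u(1)] aff_aff Zp_iff)
  then have "phi0 u \<in> Qp_Rats p"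
    using assms(2) aff_rational by simp
  then show ?thesis
    using phi0_rational_imp[OF u(1)] u(2) aff_rational by simp
qed

end

theorem mainTheorem4:
  fixes p :: nat and q :: int
  assumes "prime p" and "q \<noteq> 0" and "coprime q (int p)"
  shows "{x \<in> carrier (Qp p). phi p q x \<in> Qp_Rats p} \<subseteq> Qp_Rats p"
proof -
  have "padic_map p (Qp p) q"
    using assms by (simp add: padic_map_def padic_def padic_map_axioms_def)
  then show ?thesis
    using padic_map.phi_rational_imp by blast
qed

end
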